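(* Let $V$ be an absolute matrix order unit space satisfying the following two conditions for all $l,m,n\in\mathbb{N}$: (T) if $u \in \mathcal{PI}_{m,n}(V)$ and $v \in \mathcal{PI}_{l,n}(V)$ with $\vert u \vert_{m,n} = \vert v \vert_{l,n}$, then there exists $w \in \mathcal{PI}_{m,l}(V)$ such that $\vert w^* \vert_{l,m} = \vert u^* \vert_{n,m}$ and $\vert w \vert_{m,l} = \vert v^* \vert_{n,l}$; (H) if $u \in \mathcal{PI}_{m,n}(V)$ and $p \in \mathcal{OP}_n(V)$ with $p \le \vert u \vert_{m,n}$, then there exists $u_1 \in \mathcal{PI}_{m,n}(V)$ with $u_1 \perp (u - u_1)$ such that $p = \vert u_1 \vert_{m,n}$. Then: (1) $\preceq$ is a reflexive and transitive relation on $\mathcal{OP}_\infty(V)$. (2) Let $p, q, r, s \in \mathcal{OP}_\infty(V)$. If $p \preceq r$ and $q \preceq s$, then $p \oplus q \preceq r \oplus s$.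
   Context: A real ordered vector space $(E,E^+)$ is a real vector space with a cone $E^+$ (closed under addition and multiplication by nonnegative scalars); $u \le v$ means $v-u \in E^+$. It is an absolutely ordered space if there is a map $\vert\cdot\vert : E \to E^+$ such that: (1) $\vert v\vert = v$ if $v \in E^+$; (2) $\vert v \vert \pm v \in E^+$ for all $v$; (3) $\vert kv\vert = \vert k\vert \vert v\vert$ for $k \in \mathbb{R}$; (4) if $\vert u-v\vert = u+v$ and $0 \le w \le v$, then $\vert u-w\vert = u+w$; (5) if $\vert u-v\vert = u+v$ and $\vert u-w\vert = u+w$, then $\vert u - \vert v\pm w\vert\vert = u + \vert v \pm w\vert$. In it, $u\perp v$ means $\vert\,\vert u\vert-\vert v\vert\,\vert=\vert u\vert+\vert v\vert$. For a $*$-vector space $V$ (complex vector space with conjugate-linear involution), $M_{m,n}(V)$ is the space of $m\times n$ matrices over $V$, $M_{m,n}=M_{m,n}(\mathbb{C})$ with the operator norm, $M_n(V)=M_{n,n}(V)$, $[v_{ij}]^*=[v_{ji}^*]$, $M_n(V)_{sa}$ is the set of self-adjoint elements, and $v\oplus w=\begin{bmatrix} v&0\\0&w\end{bmatrix}$. A matrix ordered space is a $*$-vector space $V$ with cones $M_n(V)^+\subset M_n(V)_{sa}$ ($n\in\mathbb{N}$) such that each $(M_n(V)_{sa},M_n(V)^+)$ is a real ordered vector space and $\alpha^*v\alpha\in M_m(V)^+$ for all $v\in M_n(V)^+$, $\alpha\in M_{n,m}$; write $V^+=M_1(V)^+$. An absolutely matrix ordered space is a matrix ordered space with maps $\vert\cdot\vert_{m,n}:M_{m,n}(V)\to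 M_n(V)^+$ (write $\vert\cdot\vert_n=\vert\cdot\vert_{n,n}$) such that: (i) each $(M_n(V)_{sa},M_n(V)^+,\vert\cdot\vert_n)$ is an absolutely ordered space; (ii) $\vert\alpha v\beta\vert_{r,s}\le\|\alpha\|\,\vert\,\vert v\vert_{m,n}\beta\vert_{n,s}$ for $v\in M_{m,n}(V)$, $\alpha\in M_{r,m}$, $\beta\in M_{n,s}$; (iii) $\vert v\oplus w\vert_{m+r,n+s}=\vert v\vert_{m,n}\oplus\vert w\vert_{r,s}$ for $v\in M_{m,n}(V)$, $w\in M_{r,s}(V)$. For $u,v\in M_{m,n}(V)$, $u\perp v$ means $\begin{bmatrix}0&u\\ u^*&0\end{bmatrix}\perp\begin{bmatrix}0&v\\ v^*&0\end{bmatrix}$ in $M_{m+n}(V)_{sa}$. A matrix order unit space $(V,e)$ is a matrix ordered space with an order unit $e\in V^+$ (for each $v\in V_{sa}$ there is $k>0$ with $ke\pm v\in V^+$) such that $V^+\cap(-V^+)=\{0\}$ and each $M_n(V)^+$ is Archimedean (if $u,v\in M_n(V)_{sa}$ and $v+ku\in M_n(V)^+$ for all $k>0$ then $v\in M_n(V)^+$). Put $e^n=e\oplus\cdots\oplus e\in M_n(V)$; the norm on $M_n(V)$ is $\|v\|_n=\inf\{k>0:\begin{bmatrix}ke^n&v\\ v^*&ke^n\end{bmatrix}\in M_{2n}(V)^+\}$. For $u,v\in M_n(V)_{sa}$, $u\perp_\infty v$ means $\|u+kv\|_n=\max\{\|u\|_n,\|kv\|_n\}$ for all $k\in\mathbb{R}$.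 For $u,v\in M_n(V)^+$, $u\perp_\infty^a v$ means $u_1\perp_\infty v_1$ whenever $0\le u_1\le u$ and $0\le v_1\le v$. An absolute matrix order unit space is a matrix order unit space that is an absolutely matrix ordered space and in which $\perp=\perp_\infty^a$ on $M_n(V)^+$ for all $n$. An order projection in $M_n(V)$ is $p=p^*\in M_n(V)$ with $\vert 2p-e^n\vert_n=e^n$; $\mathcal{OP}_n(V)$ is the set of these, and $\mathcal{OP}_\infty(V)=\{p: p\in\mathcal{OP}_n(V)\text{ for some }n\in\mathbb{N}\}$. $v\in M_{m,n}(V)$ is a partial isometry if $\vert v\vert_{m,n}\in\mathcal{OP}_n(V)$ and $\vert v^*\vert_{n,m}\in\mathcal{OP}_m(V)$; $\mathcal{PI}_{m,n}(V)$ is the set of these. For $p\in\mathcal{OP}_m(V)$, $q\in\mathcal{OP}_n(V)$, $p\sim q$ means there is $v\in\mathcal{PI}_{m,n}(V)$ with $p=\vert v^*\vert_{n,m}$ and $q=\vert v\vert_{m,n}$. For $p,q\in\mathcal{OP}_\infty(V)$, $p\preceq q$ means there is $r\in\mathcal{OP}_\infty(V)$ (of the same matrix size as $q$) with $p\sim r\le q$. *)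

theory Defs
  imports Jordan_Normal_Form.Schur_Decomposition
begin

section \<open>Absolutely ordered spaces\<close>

locale real_vector_space_on =
  fixes E :: "'a::{plus,minus} set" and z :: 'a and scale :: "real \<Rightarrow> 'a \<Rightarrow> 'a"
  assumes zero_closed: "z \<in> E"
    and add_closed: "\<lbrakk>u \<in> E; v \<in> E\<rbrakk> \<Longrightarrow> u + v \<in> E"
    and scale_closed: "u \<in> E \<Longrightarrow> scale k u \<in> E"
    and add_assoc: "\<lbrakk>u \<in> E; v \<in> E; w \<in> E\<rbrakk> \<Longrightarrow> (u + v) + w = u + (v + w)"
    and add_comm: "\<lbrakk>u \<in> E; v \<in> E\<rbrakk> \<Longrightarrow> u + v = v + u"
    and add_zero: "u \<in> E \<Longrightarrow> u + z = u"
    and add_inverse: "u \<in> E \<Longrightarrow> u + scale (-1) u = z"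
    and diff_eq: "\<lbrakk>u \<in> E; v \<in> E\<rbrakk> \<Longrightarrow> u - v = u + scale (-1) v"
    and scale_add_right: "\<lbrakk>u \<in> E; v \<in> E\<rbrakk> \<Longrightarrow> scale k (u + v) = scale k u + scale k v"
    and scale_add_left: "u \<in> E \<Longrightarrow> scale (k + l) u = scale k u + scale l u"
    and scale_scale: "u \<in> E \<Longrightarrow> scale k (scale l u) = scale (k * l) u"
    and scale_one: "u \<in> E \<Longrightarrow> scale 1 u = u"

definition cone_le :: "'a::minus set \<Rightarrow> 'a \<Rightarrow> 'a \<Rightarrow> bool" where
  "cone_le P u v \<longleftrightarrow> v - u \<in> P"

locale real_ordered_vector_space = real_vector_space_on E z scale
  for E :: "'a::{plus,minus} set" and z :: 'a and scale :: "real \<Rightarrow> 'a \<Rightarrow> 'a" +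
  fixes P :: "'a set"
  assumes cone_subset: "P \<subseteq> E"
    and cone_nonempty: "P \<noteq> {}"
    and cone_add: "\<lbrakk>u \<in> P; v \<in> P\<rbrakk> \<Longrightarrow> u + v \<in> P"
    and cone_scale: "\<lbrakk>u \<in> P; 0 \<le> k\<rbrakk> \<Longrightarrow> scale k u \<in> P"

locale absolutely_ordered_space = real_ordered_vector_space E z scale P
  for E :: "'a::{plus,minus} set" and z :: 'a and scale :: "real \<Rightarrow> 'a \<Rightarrow> 'a" and P :: "'a set" +
  fixes ab :: "'a \<Rightarrow> 'a"
  assumes ab_closed: "v \<in> E \<Longrightarrow> ab v \<in> P"
    and ab_pos: "v \<in> P \<Longrightarrow> ab v = v"
    and ab_plus: "v \<in> E \<Longrightarrow> ab v + v \<in> P"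
    and ab_minus: "v \<in> E \<Longrightarrow> ab v - v \<in> P"
    and ab_scale: "v \<in> E \<Longrightarrow> ab (scale k v) = scale \<bar>k\<bar> (ab v)"
    and ab_below: "\<lbrakk>u \<in> E; v \<in> E; w \<in> E; ab (u - v) = u + v; cone_le P z w; cone_le P w v\<rbrakk>
      \<Longrightarrow> ab (u - w) = u + w"
    and ab_sum: "\<lbrakk>u \<in> E; v \<in> E; w \<in> E; ab (u - v) = u + v; ab (u - w) = u + w\<rbrakk>
      \<Longrightarrow> ab (u - ab (v + w)) = u + ab (v + w)"
    and ab_diff: "\<lbrakk>u \<in> E; v \<in> E; w \<in> E; ab (u - v) = u + v; ab (u - w) = u + w\<rbrakk>
      \<Longrightarrow> ab (u - ab (v - w)) = u + ab (v - w)"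

definition abs_perp :: "('a::{plus,minus} \<Rightarrow> 'a) \<Rightarrow> 'a \<Rightarrow> 'a \<Rightarrow> bool" where
  "abs_perp ab u v \<longleftrightarrow> ab (ab u - ab v) = ab u + ab v"


section \<open>Matrices over a complex vector space with involution\<close>

text \<open>
  The vector space is the whole type \<open>'v\<close>. The maps \<open>|_|\<close> on rectangular matrices of the various
  sizes are combined into the single map \<open>mabs\<close>: a value of type \<open>'v mat\<close> carries its dimensions.
  Matrix sizes are positive throughout; what the structure does on matrices without rows or
  without columns is irrelevant.
\<close>

record 'v star_space =
  cscale :: "complex \<Rightarrow> 'v \<Rightarrow> 'v"
  invol :: "'v \<Rightarrow> 'v"

record 'v mo_space = "'v star_space" +
  cone :: "nat \<Rightarrow> 'v mat set"

record 'v amo_space = "'v mo_space" +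
  mabs :: "'v mat \<Rightarrow> 'v mat"

record 'v amou_space = "'v amo_space" +
  ounit :: 'v

locale star_vector_space = vector_space "cscale V"
  for V :: "('v::ab_group_add, 'b) star_space_scheme" +
  assumes invol_invol: "invol V (invol V x) = x"
    and invol_add: "invol V (x + y) = invol V x + invol V y"
    and invol_scale: "invol V (cscale V c x) = cscale V (cnj c) (invol V x)"

definition mstar :: "('v, 'b) star_space_scheme \<Rightarrow> 'v mat \<Rightarrow> 'v mat" where
  "mstar V v = mat (dim_col v) (dim_row v) (\<lambda>(i, j). invol V (v $$ (j, i)))"

definition rscale :: "('v, 'b) star_space_scheme \<Rightarrow> real \<Rightarrow> 'v mat \<Rightarrow> 'v mat" where
  "rscale V k v = map_mat (cscale V (complex_of_real k)) v"

definition lmul :: "('v::ab_group_add, 'b) star_space_scheme \<Rightarrow> complex mat \<Rightarrow> 'v mat \<Rightarrow> 'v mat" where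
  "lmul V \<alpha> v = mat (dim_row \<alpha>) (dim_col v)
     (\<lambda>(i, j). \<Sum>k<dim_row v. cscale V (\<alpha> $$ (i, k)) (v $$ (k, j)))"

definition rmul :: "('v::ab_group_add, 'b) star_space_scheme \<Rightarrow> 'v mat \<Rightarrow> complex mat \<Rightarrow> 'v mat" where
  "rmul V v \<beta> = mat (dim_row v) (dim_col \<beta>)
     (\<lambda>(i, j). \<Sum>k<dim_col v. cscale V (\<beta> $$ (k, j)) (v $$ (i, k)))"

definition msa :: "('v, 'b) star_space_scheme \<Rightarrow> nat \<Rightarrow> 'v mat set" where
  "msa V n = {v \<in> carrier_mat n n. mstar V v = v}"

definition dsum :: "'v::zero mat \<Rightarrow> 'v mat \<Rightarrow> 'v mat" where
  "dsum v w = four_block_mat v (0\<^sub>m (dim_row v) (dim_col w)) (0\<^sub>m (dim_row w) (dim_col v)) w"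

definition euclid_norm :: "complex vec \<Rightarrow> real" where
  "euclid_norm x = sqrt (\<Sum>i<dim_vec x. (cmod (x $ i))\<^sup>2)"

definition op_norm :: "complex mat \<Rightarrow> real" where
  "op_norm \<alpha> = Sup {euclid_norm (\<alpha> *\<^sub>v x) | x. x \<in> carrier_vec (dim_col \<alpha>) \<and> euclid_norm x \<le> 1}"

lemma (in star_vector_space) real_vector_space_on_msa:
  "real_vector_space_on (msa V n) (0\<^sub>m n n) (rscale V)"
proof -
  have invol_0: "invol V 0 = 0"
    using invol_add[of 0 0] by simp
  have idx: "invol V (u $$ (j, i)) = u $$ (i, j)" if "u \<in> msa V n" "i < n" "j < n" for u i j
  proof -
    have c: "u \<in> carrier_mat n n" "mstar V u = u" using that by (auto simp: msa_def)
    have "mstar V u $$ (i, j) = invol V (u $$ (j, i))"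
      using c(1) that(2,3) by (simp add: mstar_def)
    then show ?thesis unfolding c(2) by (rule sym)
  qed
  have car: "u \<in> carrier_mat n n" if "u \<in> msa V n" for u
    using that by (simp add: msa_def)
  have msaI: "u \<in> msa V n"
    if "u \<in> carrier_mat n n" "\<And>i j. i < n \<Longrightarrow> j < n \<Longrightarrow> invol V (u $$ (j, i)) = u $$ (i, j)" for u
    using that by (auto simp: msa_def mstar_def intro!: eq_matI)
  have m1: "cscale V (-1) x = - x" for x
    using scale_minus_left[of 1 x] scale_one by simp
  show ?thesis
  proof
    show "0\<^sub>m n n \<in> msa V n" by (rule msaI) (auto simp: invol_0)
    show "u + v \<in> msa V n" if "u \<in> msa V n" "v \<in> msa V n" for u v
      using car[OF that(1)] car[OF that(2)] by (intro msaI) (auto simp: invol_add idx that)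
    show "rscale V k u \<in> msa V n" if "u \<in> msa V n" for u k
      using car[OF that] by (intro msaI) (auto simp: rscale_def invol_scale idx that)
    show "(u + v) + w = u + (v + w)" if "u \<in> msa V n" "v \<in> msa V n" "w \<in> msa V n" for u v w
      using that[THEN car] by (auto intro!: eq_matI simp: ac_simps)
    show "u + v = v + u" if "u \<in> msa V n" "v \<in> msa V n" for u v
      using that[THEN car] by (auto intro!: eq_matI simp: ac_simps)
    show "u + 0\<^sub>m n n = u" if "u \<in> msa V n" for u
      using that[THEN car] by auto
    show "u + rscale V (-1) u = 0\<^sub>m n n" if "u \<in> msa V n" for u
      using that[THEN car] by (auto intro!: eq_matI simp: rscale_def m1)
    show "u - v = u + rscale V (-1) v" if "u \<in> msa V n" "v \<in> msa V n" for u v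
      using that[THEN car] by (auto intro!: eq_matI simp: rscale_def m1)
    show "rscale V k (u + v) = rscale V k u + rscale V k v"
      if "u \<in> msa V n" "v \<in> msa V n" for u v k
      using that[THEN car] by (auto intro!: eq_matI simp: rscale_def scale_right_distrib)
    show "rscale V (k + l) u = rscale V k u + rscale V l u" if "u \<in> msa V n" for u k l
      using that[THEN car] by (auto intro!: eq_matI simp: rscale_def scale_left_distrib)
    show "rscale V k (rscale V l u) = rscale V (k * l) u" if "u \<in> msa V n" for u k l
      using that[THEN car] by (auto intro!: eq_matI simp: rscale_def)
    show "rscale V 1 u = u" if "u \<in> msa V n" for u
      using that[THEN car] by (auto intro!: eq_matI simp: rscale_def)
  qed
qed


section \<open>Matrix ordered and absolutely matrix ordered spaces\<close>

locale matrix_ordered_space = star_vector_space V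
  for V :: "('v::ab_group_add, 'b) mo_space_scheme" +
  assumes ordered: "0 < n \<Longrightarrow> real_ordered_vector_space (msa V n) (0\<^sub>m n n) (rscale V) (cone V n)"
    and compression: "\<lbrakk>0 < m; 0 < n; v \<in> cone V n; \<alpha> \<in> carrier_mat n m\<rbrakk>
      \<Longrightarrow> lmul V (mat_adjoint \<alpha>) (rmul V v \<alpha>) \<in> cone V m"

locale absolutely_matrix_ordered_space = matrix_ordered_space V
  for V :: "('v::ab_group_add, 'b) amo_space_scheme" +
  assumes mabs_closed: "\<lbrakk>0 < m; 0 < n; v \<in> carrier_mat m n\<rbrakk> \<Longrightarrow> mabs V v \<in> cone V n"
    and abs_ordered: "0 < n \<Longrightarrow>
      absolutely_ordered_space (msa V n) (0\<^sub>m n n) (rscale V) (cone V n) (mabs V)"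
    and mabs_mul: "\<lbrakk>0 < m; 0 < n; 0 < r; 0 < s;
        v \<in> carrier_mat m n; \<alpha> \<in> carrier_mat r m; \<beta> \<in> carrier_mat n s\<rbrakk>
      \<Longrightarrow> cone_le (cone V s) (mabs V (rmul V (lmul V \<alpha> v) \<beta>))
            (rscale V (op_norm \<alpha>) (mabs V (rmul V (mabs V v) \<beta>)))"
    and mabs_dsum: "\<lbrakk>0 < m; 0 < n; 0 < r; 0 < s; v \<in> carrier_mat m n; w \<in> carrier_mat r s\<rbrakk>
      \<Longrightarrow> mabs V (dsum v w) = dsum (mabs V v) (mabs V w)"

definition mperp :: "('v::ab_group_add, 'b) amo_space_scheme \<Rightarrow> 'v mat \<Rightarrow> 'v mat \<Rightarrow> bool" where
  "mperp V u v \<longleftrightarrow>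
     (let hat = (\<lambda>x. four_block_mat (0\<^sub>m (dim_row x) (dim_row x)) x (mstar V x) (0\<^sub>m (dim_col x) (dim_col x)))
      in abs_perp (mabs V) (hat u) (hat v))"


section \<open>Absolute matrix order unit spaces\<close>

definition vpos :: "('v, 'b) mo_space_scheme \<Rightarrow> 'v set" where
  "vpos V = {x. mat 1 1 (\<lambda>_. x) \<in> cone V 1}"

definition unit_mat :: "('v::zero, 'b) amou_space_scheme \<Rightarrow> nat \<Rightarrow> 'v mat" where
  "unit_mat V n = mat n n (\<lambda>(i, j). if i = j then ounit V else 0)"

locale matrix_order_unit_space = matrix_ordered_space V
  for V :: "('v::ab_group_add, 'b) amou_space_scheme" +
  assumes unit_pos: "ounit V \<in> vpos V"
    and order_unit: "invol V x = x \<Longrightarrow>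
      \<exists>k>0. cscale V (complex_of_real k) (ounit V) + x \<in> vpos V
          \<and> cscale V (complex_of_real k) (ounit V) - x \<in> vpos V"
    and proper: "vpos V \<inter> uminus ` vpos V = {0}"
    and archimedean: "\<lbrakk>0 < n; u \<in> msa V n; v \<in> msa V n; \<And>k. 0 < k \<Longrightarrow> v + rscale V k u \<in> cone V n\<rbrakk>
      \<Longrightarrow> v \<in> cone V n"

text \<open>Meant for square matrices; the size \<open>n\<close> is read off the matrix.\<close>

definition mnorm :: "('v::ab_group_add, 'b) amou_space_scheme \<Rightarrow> 'v mat \<Rightarrow> real" where
  "mnorm V v =
     (let n = dim_row v; ke = (\<lambda>k. rscale V k (unit_mat V n))
      in Inf {k. 0 < k \<and> four_block_mat (ke k) v (mstar V v) (ke k) \<in> cone V (2 * n)})"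

definition perp_inf :: "('v::ab_group_add, 'b) amou_space_scheme \<Rightarrow> 'v mat \<Rightarrow> 'v mat \<Rightarrow> bool" where
  "perp_inf V u v \<longleftrightarrow>
     (\<forall>k. mnorm V (u + rscale V k v) = max (mnorm V u) (mnorm V (rscale V k v)))"

definition perp_inf_a :: "('v::ab_group_add, 'b) amou_space_scheme \<Rightarrow> nat \<Rightarrow> 'v mat \<Rightarrow> 'v mat \<Rightarrow> bool" where
  "perp_inf_a V n u v \<longleftrightarrow>
     (\<forall>u1\<in>cone V n. \<forall>v1\<in>cone V n.
        cone_le (cone V n) u1 u \<longrightarrow> cone_le (cone V n) v1 v \<longrightarrow> perp_inf V u1 v1)"

locale absolute_matrix_order_unit_space =
  matrix_order_unit_space V + absolutely_matrix_ordered_space V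
  for V :: "('v::ab_group_add, 'b) amou_space_scheme" +
  assumes perp_eq: "\<lbrakk>0 < n; u \<in> cone V n; v \<in> cone V n\<rbrakk>
      \<Longrightarrow> abs_perp (mabs V) u v \<longleftrightarrow> perp_inf_a V n u v"


section \<open>Order projections, partial isometries and their comparison\<close>

definition OP :: "('v::ab_group_add, 'b) amou_space_scheme \<Rightarrow> nat \<Rightarrow> 'v mat set" where
  "OP V n = {p \<in> msa V n. mabs V (rscale V 2 p - unit_mat V n) = unit_mat V n}"

definition OP_inf :: "('v::ab_group_add, 'b) amou_space_scheme \<Rightarrow> 'v mat set" where
  "OP_inf V = (\<Union>n\<in>{1..}. OP V n)"

definition PIsom :: "('v::ab_group_add, 'b) amou_space_scheme \<Rightarrow> nat \<Rightarrow> nat \<Rightarrow> 'v mat set" where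
  "PIsom V m n = {v \<in> carrier_mat m n. mabs V v \<in> OP V n \<and> mabs V (mstar V v) \<in> OP V m}"

definition proj_equiv :: "('v::ab_group_add, 'b) amou_space_scheme \<Rightarrow> 'v mat \<Rightarrow> 'v mat \<Rightarrow> bool" where
  "proj_equiv V p q \<longleftrightarrow>
     (\<exists>m\<ge>1. \<exists>n\<ge>1. p \<in> OP V m \<and> q \<in> OP V n \<and>
        (\<exists>v\<in>PIsom V m n. p = mabs V (mstar V v) \<and> q = mabs V v))"

definition proj_le :: "('v::ab_group_add, 'b) amou_space_scheme \<Rightarrow> 'v mat \<Rightarrow> 'v mat \<Rightarrow> bool" where
  "proj_le V p q \<longleftrightarrow> p \<in> OP_inf V \<and>
     (\<exists>n\<ge>1. q \<in> OP V n \<and> (\<exists>r\<in>OP V n. proj_equiv V p r \<and> cone_le (cone V n) r q))"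

end

theory Submission
  imports Defs
begin

text \<open>
  Two consequences of the axioms for absolute values carry the proof. In an absolutely ordered
  space, \<open>u \<perp> v\<close> implies \<open>|u + v| = |u| + |v|\<close> (\<open>ab_add_of_perp\<close>). For a rectangular matrix \<open>x\<close>,
  the self-adjoint dilation with off-diagonal blocks \<open>x\<close> and \<open>x\<^sup>*\<close> has absolute value
  \<open>|x\<^sup>*| \<oplus> |x|\<close> (\<open>mabs_sa_dilation\<close>): it arises from \<open>x\<^sup>* \<oplus> x\<close> by a permutation of the rows, and
  left multiplication by a permutation matrix, being contractive with contractive inverse,
  preserves absolute values. As orthogonality of rectangular matrices is orthogonality of their
  dilations, \<open>x \<perp> u - x\<close> therefore implies \<open>|u\<^sup>*| = |x\<^sup>*| + |(u - x)\<^sup>*|\<close>, whence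
  \<open>|x\<^sup>*| \<le> |u\<^sup>*|\<close>.

  For transitivity, let \<open>p \<sim> |v| \<le> q = |u\<^sup>*|\<close> and \<open>|u| \<le> t\<close>. Condition (H), applied to \<open>u\<^sup>*\<close>,
  provides a part \<open>u\<^sub>1\<close> of \<open>u\<^sup>*\<close> with \<open>|u\<^sub>1| = |v|\<close>, and \<open>|u\<^sub>1\<^sup>*| \<le> |u| \<le> t\<close> by the above.
  Condition (T) composes \<open>v\<close> and \<open>u\<^sub>1\<close> to \<open>p \<sim> |u\<^sub>1\<^sup>*|\<close>. Reflexivity holds because order
  projections are positive, hence equal to their absolute values. Compatibility with direct sums
  follows from \<open>|v \<oplus> w| = |v| \<oplus> |w|\<close>, which also makes direct sums of positive matrices positive.
\<close>

section \<open>Orthogonal elements of an absolutely ordered space\<close>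

context real_vector_space_on
begin

lemma add_lcomm: "\<lbrakk>u \<in> E; v \<in> E; w \<in> E\<rbrakk> \<Longrightarrow> u + (v + w) = v + (u + w)"
  using add_assoc[of u v w] add_assoc[of v u w] add_comm[of u v] by simp

lemma zero_add: "u \<in> E \<Longrightarrow> z + u = u"
  using add_comm[of z u] add_zero[of u] zero_closed by simp

lemma scale_zero_vector: "scale k z = z"
proof -
  let ?x = "scale k z"
  have x: "?x \<in> E" "scale (-1) ?x \<in> E"
    by (simp_all add: scale_closed zero_closed)
  have "?x + ?x = ?x"
    using scale_add_right[OF zero_closed zero_closed, of k] add_zero[OF zero_closed] by simp
  then have "?x + (?x + scale (-1) ?x) = ?x + scale (-1) ?x"
    using add_assoc[OF x(1,1,2)] by simp
  then show ?thesis
    using add_inverse[OF x(1)] add_zero[OF x(1)] by simp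
qed

lemma diff_closed: "\<lbrakk>u \<in> E; v \<in> E\<rbrakk> \<Longrightarrow> u - v \<in> E"
  by (simp add: diff_eq add_closed scale_closed)

lemma diff_zero: "u \<in> E \<Longrightarrow> u - z = u"
  by (simp add: diff_eq zero_closed scale_zero_vector add_zero)

lemma add_diff_cancel:
  assumes "u \<in> E" "v \<in> E"
  shows "(u + v) - u = v"
proof -
  have "(u + v) - u = v + (u + scale (-1) u)"
    using assms by (simp add: diff_eq add_closed scale_closed add_comm[of u v] add_assoc)
  then show ?thesis
    using assms by (simp add: add_inverse add_zero)
qed

lemma scale_half_double: "u \<in> E \<Longrightarrow> scale (1/2) u + scale (1/2) u = u"
  using scale_add_left[of u "1/2" "1/2"] scale_one[of u] by simp

lemma add_add_swap:
  "\<lbrakk>a \<in> E; b \<in> E; c \<in> E; d \<in> E\<rbrakk> \<Longrightarrow> (a + b) + (c + d) = (a + c) + (b + d)"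
  by (simp add: add_closed add_assoc add_lcomm)

lemma add_diff_add:
  assumes "a \<in> E" "b \<in> E" "c \<in> E" "d \<in> E"
  shows "(a + b) - (c + d) = (a - c) + (b - d)"
  using assms by (simp add: diff_eq add_closed scale_closed scale_add_right add_assoc add_lcomm)

lemma scale_minus_one_diff:
  assumes "u \<in> E" "v \<in> E"
  shows "scale (-1) (u - v) = v - u"
  using assms by (simp add: diff_eq scale_closed scale_add_right scale_scale scale_one add_comm)

end

context absolutely_ordered_space
begin

lemma cone_in: "u \<in> P \<Longrightarrow> u \<in> E"
  using cone_subset by blast

lemma ab_in: "u \<in> E \<Longrightarrow> ab u \<in> E"
  using ab_closed cone_in by blast

lemma ab_diff_commute:
  assumes "u \<in> E" "v \<in> E"
  shows "ab (u - v) = ab (v - u)"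
proof -
  have "ab (scale (-1) (v - u)) = scale \<bar>-1\<bar> (ab (v - u))"
    using assms by (intro ab_scale diff_closed)
  then show ?thesis
    using assms by (simp add: scale_minus_one_diff scale_one ab_in diff_closed)
qed

lemma pos_neg_parts:
  assumes "u \<in> E"
  obtains p q where "p \<in> P" "q \<in> P" "u = p - q" "ab u = p + q"
proof
  let ?p = "scale (1/2) (ab u + u)" and ?q = "scale (1/2) (ab u - u)"
  show "?p \<in> P" "?q \<in> P"
    using assms by (auto intro!: cone_scale ab_plus ab_minus)
  have E: "ab u \<in> E" "u \<in> E" "scale (-1) u \<in> E" "scale (1/2) (ab u) \<in> E" "scale (1/2) u \<in> E"
    "scale (-1/2) u \<in> E" "scale (-1/2) (ab u) \<in> E"
    using assms ab_in scale_closed by auto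
  have z: "scale (1/2) x + scale (- (1/2)) x = z" if "x \<in> E" for x
    using add_inverse[of "scale (1/2) x"] that by (simp add: scale_closed scale_scale)
  have "?p - ?q = (scale (1/2) (ab u) + scale (1/2) u)
      + (scale (-1/2) (ab u) + scale (1/2) u)"
    using E by (simp add: diff_eq scale_closed scale_add_right scale_scale add_closed)
  also have "\<dots> = (scale (1/2) (ab u) + scale (-1/2) (ab u))
      + (scale (1/2) u + scale (1/2) u)"
    using E by (simp add: add_assoc add_lcomm add_closed)
  finally show "u = ?p - ?q"
    using E by (simp add: z scale_half_double zero_add)
  have "?p + ?q = (scale (1/2) (ab u) + scale (1/2) u)
      + (scale (1/2) (ab u) + scale (-1/2) u)"
    using E by (simp add: diff_eq scale_closed scale_add_right scale_scale)
  also have "\<dots> = (scale (1/2) (ab u) + scale (1/2) (ab u))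
      + (scale (1/2) u + scale (-1/2) u)"
    using E by (simp add: add_assoc add_lcomm add_closed)
  finally show "ab u = ?p + ?q"
    using E by (simp add: z scale_half_double add_zero)
qed

lemma perp_mono_right:
  assumes "u \<in> P" "v \<in> P" "w \<in> P" "ab (u - (v + w)) = u + (v + w)"
  shows "ab (u - v) = u + v"
proof (rule ab_below[OF _ _ _ assms(4)])
  show "cone_le P z v" "cone_le P v (v + w)"
    using assms cone_in by (simp_all add: cone_le_def diff_zero add_diff_cancel)
qed (use assms cone_in add_closed in auto)

lemma perp_sym:
  assumes "u \<in> P" "v \<in> P" "ab (u - v) = u + v"
  shows "ab (v - u) = v + u"
  using assms ab_diff_commute add_comm cone_in by force

lemma perp_parts:
  assumes "a \<in> P" "b \<in> P" "c \<in> P" "d \<in> P" "ab ((a + b) - (c + d)) = (a + b) + (c + d)"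
  shows "ab (a - c) = a + c"
proof -
  have ab: "a + b \<in> P" using assms cone_add by blast
  have "ab ((a + b) - c) = (a + b) + c"
    using perp_mono_right[OF ab assms(3-5)] .
  then have "ab (c - a) = c + a"
    using perp_mono_right[OF assms(3,1,2)] perp_sym[OF ab assms(3)] by blast
  then show ?thesis
    by (rule perp_sym[OF assms(3,1)])
qed

lemma perp_add:
  assumes "u \<in> P" "v \<in> P" "w \<in> P" "ab (u - v) = u + v" "ab (u - w) = u + w"
  shows "ab (u - (v + w)) = u + (v + w)"
  using ab_sum[of u v w] assms by (simp add: ab_pos cone_add cone_in)

text \<open>
  If \<open>u = p - q\<close> and \<open>v = p' - q'\<close> are the decompositions into positive and negative parts, then
  each of \<open>p, p'\<close> is orthogonal to each of \<open>q, q'\<close>, so that \<open>p + p'\<close> is orthogonal to \<open>q + q'\<close>.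
\<close>

theorem ab_add_of_perp:
  assumes u: "u \<in> E" and v: "v \<in> E" and perp: "abs_perp ab u v"
  shows "ab (u + v) = ab u + ab v"
proof -
  obtain p q where pq: "p \<in> P" "q \<in> P" "u = p - q" "ab u = p + q"
    using pos_neg_parts[OF u] .
  obtain p' q' where pq': "p' \<in> P" "q' \<in> P" "v = p' - q'" "ab v = p' + q'"
    using pos_neg_parts[OF v] .
  note E = pq(1,2)[THEN cone_in] pq'(1,2)[THEN cone_in]
  have Q: "q + q' \<in> P" using pq(2) pq'(2) by (rule cone_add)
  have "ab ((p + q) - (p' + q')) = (p + q) + (p' + q')"
    using perp unfolding abs_perp_def pq(4) pq'(4) .
  then have "ab ((p + q) - (q' + p')) = (p + q) + (q' + p')"
    and "ab ((q + p) - (p' + q')) = (q + p) + (p' + q')"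
    using add_comm[OF E(3,4)] add_comm[OF E(1,2)] by simp_all
  then have pq'': "ab (p - q') = p + q'" and "ab (q - p') = q + p'"
    using perp_parts pq(1,2) pq'(1,2) by blast+
  then have p'q: "ab (p' - q) = p' + q"
    using perp_sym[OF pq(2) pq'(1)] by blast
  have "ab (p - q) = p + q" "ab (p' - q') = p' + q'"
    using pq(3,4) pq'(3,4) by simp_all
  then have "ab (p - (q + q')) = p + (q + q')" "ab (p' - (q + q')) = p' + (q + q')"
    using perp_add[OF pq(1,2) pq'(2)] perp_add[OF pq'(1) pq(2) pq'(2)] pq'' p'q by blast+
  then have "ab ((q + q') - p) = (q + q') + p" "ab ((q + q') - p') = (q + q') + p'"
    using perp_sym[OF pq(1) Q] perp_sym[OF pq'(1) Q] by blast+
  then have "ab ((p + p') - (q + q')) = (p + p') + (q + q')"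
    by (intro perp_sym[OF Q cone_add[OF pq(1) pq'(1)]] perp_add[OF Q pq(1) pq'(1)])
  moreover have "u + v = (p + p') - (q + q')"
    unfolding pq(3) pq'(3) using E by (intro add_diff_add[symmetric])
  moreover have "ab u + ab v = (p + p') + (q + q')"
    unfolding pq(4) pq'(4) using E by (intro add_add_swap)
  ultimately show ?thesis by simp
qed

text \<open>
  Properness of the cone is not an axiom, but follows from the absolute value: \<open>|-u| = |u|\<close>
  forces \<open>-u = u\<close> if both \<open>u\<close> and \<open>-u\<close> are positive.
\<close>

lemma cone_proper:
  assumes "u \<in> P" "scale (-1) u \<in> P"
  shows "u = z"
proof -
  have "scale (-1) u = ab (scale (-1) u)"
    using assms ab_pos by simp
  also have "\<dots> = scale \<bar>-1\<bar> (ab u)"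
    using assms by (intro ab_scale cone_in)
  also have "\<dots> = u"
    using assms by (simp add: ab_pos scale_one cone_in)
  finally have "u + u = z"
    using add_inverse[of u] cone_in assms by simp
  then have "scale (1/2) (u + u) = z"
    by (simp add: scale_zero_vector)
  then show ?thesis
    using assms cone_in by (simp add: scale_add_right scale_half_double)
qed

end


section \<open>Matrices over an absolutely matrix ordered space\<close>

lemma dsum_carrier [simp]:
  "\<lbrakk>v \<in> carrier_mat m n; w \<in> carrier_mat r s\<rbrakk> \<Longrightarrow> dsum v w \<in> carrier_mat (m + r) (n + s)"
  by (auto simp: dsum_def)

lemma dsum_minus:
  assumes "a \<in> carrier_mat m n" "b \<in> carrier_mat r s"
    and "c \<in> carrier_mat m n" "d \<in> carrier_mat r s"
  shows "dsum a b - dsum c d = dsum (a - c) (b - d :: 'v::ab_group_add mat)"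
  using assms by (intro eq_matI) (auto simp: dsum_def)

lemma dsum_add:
  assumes "a \<in> carrier_mat m n" "b \<in> carrier_mat r s"
    and "c \<in> carrier_mat m n" "d \<in> carrier_mat r s"
  shows "dsum a b + dsum c d = dsum (a + c) (b + d :: 'v::ab_group_add mat)"
  using assms by (intro eq_matI) (auto simp: dsum_def)

lemma dsum_eq_left:
  assumes "dsum a b = dsum c d"
    and "a \<in> carrier_mat m n" "c \<in> carrier_mat m n"
  shows "a = c"
proof (rule eq_matI)
  fix i j assume ij: "i < dim_row c" "j < dim_col c"
  have "dsum a b $$ (i, j) = dsum c d $$ (i, j)"
    using assms(1) by simp
  then show "a $$ (i, j) = c $$ (i, j)"
    using ij assms(2,3) by (auto simp: dsum_def)
qed (use assms in auto)

lemma dsum_unit_mat: "dsum (unit_mat V m) (unit_mat V n) = unit_mat V (m + n)"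
  by (intro eq_matI) (auto simp: dsum_def unit_mat_def)

lemma mstar_carrier [simp]: "v \<in> carrier_mat m n \<Longrightarrow> mstar V v \<in> carrier_mat n m"
  by (auto simp: mstar_def)

lemma rscale_carrier [simp]: "v \<in> carrier_mat m n \<Longrightarrow> rscale V k v \<in> carrier_mat m n"
  by (auto simp: rscale_def)

lemma unit_mat_carrier [simp]: "unit_mat V n \<in> carrier_mat n n"
  by (auto simp: unit_mat_def)

lemma msa_carrier: "v \<in> msa V n \<Longrightarrow> v \<in> carrier_mat n n"
  by (simp add: msa_def)

text \<open>The self-adjoint matrix with the off-diagonal blocks \<open>x\<close> and \<open>x\<^sup>*\<close>.\<close>

definition sa_dilation :: "('v::zero, 'b) star_space_scheme \<Rightarrow> 'v mat \<Rightarrow> 'v mat" where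
  "sa_dilation V x =
     four_block_mat (0\<^sub>m (dim_row x) (dim_row x)) x (mstar V x) (0\<^sub>m (dim_col x) (dim_col x))"

context star_vector_space
begin

lemma invol_zero: "invol V 0 = 0"
  using invol_add[of 0 0] by simp

lemma mstar_mstar: "mstar V (mstar V v) = v"
  by (intro eq_matI) (auto simp: mstar_def invol_invol)

lemma mstar_dsum: "mstar V (dsum v w) = dsum (mstar V v) (mstar V w)"
  by (intro eq_matI) (auto simp: mstar_def dsum_def invol_zero)

lemma rscale_dsum: "rscale V k (dsum v w) = dsum (rscale V k v) (rscale V k w)"
  by (intro eq_matI) (auto simp: rscale_def dsum_def)

lemma dsum_msa: "\<lbrakk>v \<in> msa V m; w \<in> msa V n\<rbrakk> \<Longrightarrow> dsum v w \<in> msa V (m + n)"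
  by (auto simp: msa_def mstar_dsum)

lemma sa_dilation_msa: "x \<in> carrier_mat m n \<Longrightarrow> sa_dilation V x \<in> msa V (m + n)"
  unfolding msa_def sa_dilation_def
  by (auto intro!: eq_matI simp: mstar_def invol_invol invol_zero)

lemma sa_dilation_add:
  assumes "x \<in> carrier_mat m n" "y \<in> carrier_mat m n"
  shows "sa_dilation V (x + y) = sa_dilation V x + sa_dilation V y"
  using assms by (intro eq_matI) (auto simp: sa_dilation_def mstar_def invol_add)

lemma rmul_one: "v \<in> carrier_mat m n \<Longrightarrow> rmul V v (1\<^sub>m n) = v"
proof (rule eq_matI)
  fix i j assume v: "v \<in> carrier_mat m n" and ij: "i < dim_row v" "j < dim_col v"
  have "cscale V (1\<^sub>m n $$ (k, j)) (v $$ (i, k)) = (if k = j then v $$ (i, k) else 0)"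
    if "k < n" for k using that v ij by auto
  then show "rmul V v (1\<^sub>m n) $$ (i, j) = v $$ (i, j)"
    using v ij by (simp add: rmul_def)
qed (auto simp: rmul_def)

end

text \<open>The matrix whose \<open>i\<close>-th row is the \<open>\<sigma> i\<close>-th row of \<open>v\<close>.\<close>

definition select_rows :: "(nat \<Rightarrow> nat) \<Rightarrow> 'v mat \<Rightarrow> 'v mat" where
  "select_rows \<sigma> v = mat (dim_row v) (dim_col v) (\<lambda>(i, j). v $$ (\<sigma> i, j))"

text \<open>
  The matrix that implements this selection by left multiplication; it is a permutation matrix
  when \<open>\<sigma>\<close> permutes \<open>{..<n}\<close>.
\<close>

definition select_mat :: "nat \<Rightarrow> (nat \<Rightarrow> nat) \<Rightarrow> complex mat" where
  "select_mat n \<sigma> = mat n n (\<lambda>(i, j). if j = \<sigma> i then 1 else 0)"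

lemma op_norm_select_mat:
  assumes \<sigma>: "bij_betw \<sigma> {..<n} {..<n}"
  shows "op_norm (select_mat n \<sigma>) \<le> 1"
  unfolding op_norm_def
proof (rule cSup_least)
  have "euclid_norm (0\<^sub>v n) \<le> 1"
    by (simp add: euclid_norm_def)
  then show "{euclid_norm (select_mat n \<sigma> *\<^sub>v x) | x.
      x \<in> carrier_vec (dim_col (select_mat n \<sigma>)) \<and> euclid_norm x \<le> 1} \<noteq> {}"
    by (auto simp: select_mat_def intro!: exI[of _ "0\<^sub>v n"])
next
  fix t assume "t \<in> {euclid_norm (select_mat n \<sigma> *\<^sub>v x) | x.
      x \<in> carrier_vec (dim_col (select_mat n \<sigma>)) \<and> euclid_norm x \<le> 1}"
  then obtain x where x: "x \<in> carrier_vec n" "euclid_norm x \<le> 1"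
    and t: "t = euclid_norm (select_mat n \<sigma> *\<^sub>v x)"
    by (auto simp: select_mat_def)
  have "(select_mat n \<sigma> *\<^sub>v x) $ i = x $ \<sigma> i" if "i < n" for i
  proof -
    have "\<sigma> i < n" using \<sigma> that by (auto simp: bij_betw_def)
    moreover have "(select_mat n \<sigma> *\<^sub>v x) $ i = (\<Sum>k<n. (if k = \<sigma> i then 1 else 0) * x $ k)"
      using x that by (simp add: select_mat_def scalar_prod_def atLeast0LessThan)
    ultimately show ?thesis by (simp add: if_distrib[of "\<lambda>c. c * _"] cong: if_cong)
  qed
  then have "(\<Sum>i<n. (cmod ((select_mat n \<sigma> *\<^sub>v x) $ i))\<^sup>2) = (\<Sum>i<n. (cmod (x $ \<sigma> i))\<^sup>2)"
    by simp
  also have "\<dots> = (\<Sum>i<n. (cmod (x $ i))\<^sup>2)"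
    by (rule sum.reindex_bij_betw[OF \<sigma>])
  finally show "t \<le> 1"
    using x by (simp add: t euclid_norm_def select_mat_def)
qed

lemma (in star_vector_space) lmul_select_mat:
  assumes \<sigma>: "bij_betw \<sigma> {..<n} {..<n}" and v: "v \<in> carrier_mat n k"
  shows "lmul V (select_mat n \<sigma>) v = select_rows \<sigma> v"
proof (rule eq_matI)
  fix i j assume ij: "i < dim_row (select_rows \<sigma> v)" "j < dim_col (select_rows \<sigma> v)"
  have "\<sigma> i < n" using \<sigma> v ij by (auto simp: bij_betw_def select_rows_def)
  moreover have "cscale V (select_mat n \<sigma> $$ (i, l)) (v $$ (l, j))
      = (if l = \<sigma> i then v $$ (l, j) else 0)" if "l < n" for l
    using that v ij by (auto simp: select_mat_def select_rows_def)
  ultimately show "lmul V (select_mat n \<sigma>) v $$ (i, j) = select_rows \<sigma> v $$ (i, j)"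
    using v ij by (simp add: lmul_def select_rows_def select_mat_def)
qed (use v in \<open>auto simp: lmul_def select_rows_def select_mat_def\<close>)

context absolutely_matrix_ordered_space
begin

lemma cone_msa: "\<lbrakk>0 < n; v \<in> cone V n\<rbrakk> \<Longrightarrow> v \<in> msa V n"
  using real_ordered_vector_space.cone_subset[OF ordered] by blast

lemma cone_carrier: "\<lbrakk>0 < n; v \<in> cone V n\<rbrakk> \<Longrightarrow> v \<in> carrier_mat n n"
  by (rule msa_carrier[OF cone_msa])

lemma mabs_carrier: "\<lbrakk>0 < m; 0 < n; v \<in> carrier_mat m n\<rbrakk> \<Longrightarrow> mabs V v \<in> carrier_mat n n"
  by (rule cone_carrier[OF _ mabs_closed])

lemma mabs_cone: "\<lbrakk>0 < n; v \<in> cone V n\<rbrakk> \<Longrightarrow> mabs V v = v"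
  by (rule absolutely_ordered_space.ab_pos[OF abs_ordered])

lemma cone_le_refl:
  assumes "0 < n" "v \<in> cone V n"
  shows "cone_le (cone V n) v v"
proof -
  interpret real_ordered_vector_space "msa V n" "0\<^sub>m n n" "rscale V" "cone V n"
    using assms(1) by (rule ordered)
  have "v - v = rscale V 0 v"
    using cone_carrier[OF assms] by (auto intro!: eq_matI simp: rscale_def)
  then show ?thesis
    using cone_scale[of v 0] assms by (simp add: cone_le_def)
qed

lemma cone_le_trans:
  assumes "0 < n" "u \<in> carrier_mat n n" "v \<in> carrier_mat n n" "w \<in> carrier_mat n n"
    and "cone_le (cone V n) u v" "cone_le (cone V n) v w"
  shows "cone_le (cone V n) u w"
proof -
  interpret real_ordered_vector_space "msa V n" "0\<^sub>m n n" "rscale V" "cone V n"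
    using assms(1) by (rule ordered)
  have "w - u = (w - v) + (v - u)"
    using assms(2-4) by (auto intro!: eq_matI)
  then show ?thesis
    using cone_add[of "w - v" "v - u"] assms by (simp add: cone_le_def)
qed

lemma cone_le_antisym:
  assumes "0 < n" "u \<in> carrier_mat n n" "v \<in> carrier_mat n n"
    and "cone_le (cone V n) u v" "cone_le (cone V n) v u"
  shows "u = v"
proof -
  interpret absolutely_ordered_space "msa V n" "0\<^sub>m n n" "rscale V" "cone V n" "mabs V"
    using assms(1) by (rule abs_ordered)
  have "rscale V (-1) (v - u) = u - v"
    using assms(2,3) by (auto intro!: eq_matI simp: rscale_def)
  then have z: "v - u = 0\<^sub>m n n"
    using cone_proper[of "v - u"] assms(4,5) by (simp add: cone_le_def)
  show ?thesis
  proof (rule eq_matI)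
    fix i j assume ij: "i < dim_row v" "j < dim_col v"
    have "(v - u) $$ (i, j) = 0" using z ij assms by simp
    then show "u $$ (i, j) = v $$ (i, j)" using ij assms by simp
  qed (use assms in auto)
qed

lemma rscale_cone_le:
  assumes "0 < n" "v \<in> cone V n" "k \<le> 1"
  shows "cone_le (cone V n) (rscale V k v) v"
proof -
  interpret real_ordered_vector_space "msa V n" "0\<^sub>m n n" "rscale V" "cone V n"
    using assms(1) by (rule ordered)
  have "v - rscale V k v = rscale V (1 - k) v"
    using cone_carrier[OF assms(1,2)]
    by (auto intro!: eq_matI simp: rscale_def scale_left_diff_distrib)
  then show ?thesis
    using cone_scale[of v "1 - k"] assms by (simp add: cone_le_def)
qed

text \<open>A direct sum of positive matrices is its own absolute value, hence positive.\<close>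

lemma dsum_cone:
  assumes "0 < m" "0 < n" "v \<in> cone V m" "w \<in> cone V n"
  shows "dsum v w \<in> cone V (m + n)"
proof -
  have c: "v \<in> carrier_mat m m" "w \<in> carrier_mat n n"
    using cone_carrier[OF assms(1,3)] cone_carrier[OF assms(2,4)] .
  have "mabs V (dsum v w) = dsum v w"
    using mabs_dsum[OF assms(1,1,2,2) c] mabs_cone[OF assms(1,3)] mabs_cone[OF assms(2,4)]
    by simp
  moreover have "mabs V (dsum v w) \<in> cone V (m + n)"
    using assms(1) by (intro mabs_closed[of "m + n"] dsum_carrier c) auto
  ultimately show ?thesis by simp
qed

lemma cone_le_dsum:
  assumes "0 < m" "0 < n" "u \<in> carrier_mat m m" "v \<in> carrier_mat m m"
    and "w \<in> carrier_mat n n" "x \<in> carrier_mat n n"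
    and "cone_le (cone V m) u v" "cone_le (cone V n) w x"
  shows "cone_le (cone V (m + n)) (dsum u w) (dsum v x)"
  using dsum_cone[OF assms(1,2), of "v - u" "x - w"] dsum_minus[OF assms(4,6,3,5)] assms(7,8)
  by (simp add: cone_le_def)

lemma mabs_select_rows_le:
  assumes "0 < n" "0 < k" and \<sigma>: "bij_betw \<sigma> {..<n} {..<n}" and v: "v \<in> carrier_mat n k"
  shows "cone_le (cone V k) (mabs V (select_rows \<sigma> v)) (mabs V v)"
proof -
  have row: "select_rows \<sigma> v \<in> carrier_mat n k"
    using v by (simp add: select_rows_def)
  have "mabs V v \<in> cone V k"
    using assms(1,2) v by (rule mabs_closed)
  then have abs: "mabs V v \<in> carrier_mat k k" "mabs V (mabs V v) = mabs V v"
    using cone_carrier[OF assms(2)] mabs_cone[OF assms(2)] by blast+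
  have "cone_le (cone V k) (mabs V (rmul V (lmul V (select_mat n \<sigma>) v) (1\<^sub>m k)))
      (rscale V (op_norm (select_mat n \<sigma>)) (mabs V (rmul V (mabs V v) (1\<^sub>m k))))"
    using v by (intro mabs_mul[of n k n k] assms(1,2)) (auto simp: select_mat_def)
  then have "cone_le (cone V k) (mabs V (select_rows \<sigma> v))
      (rscale V (op_norm (select_mat n \<sigma>)) (mabs V v))"
    by (simp only: lmul_select_mat[OF \<sigma> v] rmul_one[OF row] rmul_one[OF abs(1)] abs(2))
  moreover have "cone_le (cone V k) (rscale V (op_norm (select_mat n \<sigma>)) (mabs V v)) (mabs V v)"
    using assms(2) \<open>mabs V v \<in> cone V k\<close> op_norm_select_mat[OF \<sigma>] by (rule rscale_cone_le)
  ultimately show ?thesis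
    by (rule cone_le_trans[OF \<open>0 < k\<close> mabs_carrier[OF \<open>0 < n\<close> \<open>0 < k\<close> row]
          rscale_carrier[OF abs(1)] abs(1)])
qed

text \<open>
  A permutation of the rows preserves the absolute value, by the preceding estimate for it and
  for its inverse.
\<close>

lemma mabs_select_rows:
  assumes "0 < n" "0 < k" and \<sigma>: "bij_betw \<sigma> {..<n} {..<n}" and v: "v \<in> carrier_mat n k"
  shows "mabs V (select_rows \<sigma> v) = mabs V v"
proof -
  define \<tau> where "\<tau> = inv_into {..<n} \<sigma>"
  have \<tau>: "bij_betw \<tau> {..<n} {..<n}" and st: "\<And>i. i < n \<Longrightarrow> \<sigma> (\<tau> i) = i"
    unfolding \<tau>_def using \<sigma>
    by (auto simp: bij_betw_inv_into bij_betw_inv_into_right)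
  have row: "select_rows \<sigma> v \<in> carrier_mat n k"
    using v by (simp add: select_rows_def)
  have "\<tau> i < n" if "i < n" for i
    using \<tau> that by (auto simp: bij_betw_def)
  then have "select_rows \<tau> (select_rows \<sigma> v) = v"
    using v by (auto intro!: eq_matI simp: select_rows_def st)
  then have "cone_le (cone V k) (mabs V v) (mabs V (select_rows \<sigma> v))"
    using mabs_select_rows_le[OF assms(1,2) \<tau> row] by simp
  then show ?thesis
    by (rule cone_le_antisym[OF \<open>0 < k\<close> mabs_carrier[OF assms(1,2) row]
          mabs_carrier[OF assms(1,2) v] mabs_select_rows_le[OF assms]])
qed

text \<open>
  Exchanging the two blocks of rows turns \<open>x\<^sup>* \<oplus> x\<close> into the self-adjoint dilation of \<open>x\<close>.
\<close>

lemma mabs_sa_dilation: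
  assumes "0 < m" "0 < n" and x: "x \<in> carrier_mat m n"
  shows "mabs V (sa_dilation V x) = dsum (mabs V (mstar V x)) (mabs V x)"
proof -
  \<comment> \<open>the upper \<open>m\<close> rows of the dilation are the lower \<open>m\<close> rows of \<open>x\<^sup>* \<oplus> x\<close>\<close>
  let ?\<sigma> = "\<lambda>i. if i < m then i + n else i - m"
  have "bij_betw ?\<sigma> {..<m + n} {..<m + n}"
    by (rule bij_betw_byWitness[where f' = "\<lambda>i. if i < n then i + m else i - n"]) auto
  then have \<sigma>: "bij_betw ?\<sigma> {..<n + m} {..<n + m}"
    by (simp add: add.commute)
  have c: "dsum (mstar V x) x \<in> carrier_mat (n + m) (m + n)"
    using x by simp
  have "sa_dilation V x = select_rows ?\<sigma> (dsum (mstar V x) x)"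
    using x by (intro eq_matI) (auto simp: sa_dilation_def select_rows_def dsum_def mstar_def)
  then have "mabs V (sa_dilation V x) = mabs V (dsum (mstar V x) x)"
    using mabs_select_rows[OF _ _ \<sigma> c] assms by simp
  also have "\<dots> = dsum (mabs V (mstar V x)) (mabs V x)"
    using assms by (intro mabs_dsum[of n m m n]) auto
  finally show ?thesis .
qed

lemma mabs_mstar_add_of_mperp:
  assumes "0 < m" "0 < n" and x: "x \<in> carrier_mat m n" and y: "y \<in> carrier_mat m n"
    and perp: "mperp V x y"
  shows "mabs V (mstar V (x + y)) = mabs V (mstar V x) + mabs V (mstar V y)"
proof -
  interpret absolutely_ordered_space "msa V (m + n)" "0\<^sub>m (m + n) (m + n)" "rscale V"
      "cone V (m + n)" "mabs V"
    using abs_ordered assms by simp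
  have xy: "x + y \<in> carrier_mat m n" using x y by simp
  have cs: "mabs V (mstar V v) \<in> carrier_mat m m" "mabs V v \<in> carrier_mat n n"
    if "v \<in> carrier_mat m n" for v
    using that by (auto intro!: mabs_carrier[of n m] mabs_carrier[of m n] assms)
  have "abs_perp (mabs V) (sa_dilation V x) (sa_dilation V y)"
    using perp by (simp add: mperp_def sa_dilation_def)
  then have "mabs V (sa_dilation V (x + y)) = mabs V (sa_dilation V x) + mabs V (sa_dilation V y)"
    using ab_add_of_perp sa_dilation_msa[OF x] sa_dilation_msa[OF y] sa_dilation_add[OF x y]
    by simp
  then have "dsum (mabs V (mstar V (x + y))) (mabs V (x + y))
      = dsum (mabs V (mstar V x) + mabs V (mstar V y)) (mabs V x + mabs V y)"
    by (simp only: mabs_sa_dilation[OF assms(1,2)] xy x y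
        dsum_add[OF cs(1)[OF x] cs(2)[OF x] cs(1)[OF y] cs(2)[OF y]])
  then show ?thesis
    by (rule dsum_eq_left[OF _ cs(1)[OF xy] add_carrier_mat[OF cs(1)[OF y]]])
qed

lemma mabs_mstar_le_of_mperp:
  assumes "0 < m" "0 < n" and u: "u \<in> carrier_mat m n" and x: "x \<in> carrier_mat m n"
    and perp: "mperp V x (u - x)"
  shows "cone_le (cone V m) (mabs V (mstar V x)) (mabs V (mstar V u))"
proof -
  have "x + (u - x) = u"
    using u x by (auto intro!: eq_matI)
  then have eq: "mabs V (mstar V u) = mabs V (mstar V x) + mabs V (mstar V (u - x))"
    using mabs_mstar_add_of_mperp[OF assms(1,2) x minus_carrier_mat[OF x] perp] by simp
  have pos: "mabs V (mstar V v) \<in> cone V m" if "v \<in> carrier_mat m n" for v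
    using that assms mabs_closed[of n m "mstar V v"] by simp
  note pos' = pos[OF x] pos[OF minus_carrier_mat[OF x, of u]]
  have "mabs V (mstar V u) - mabs V (mstar V x) = mabs V (mstar V (u - x))"
    unfolding eq using pos'[THEN cone_carrier[OF \<open>0 < m\<close>]] by (intro eq_matI) auto
  then show ?thesis
    using pos'(2) by (simp add: cone_le_def)
qed

end

section \<open>Comparison of order projections\<close>

lemma OP_carrier: "p \<in> OP V n \<Longrightarrow> p \<in> carrier_mat n n"
  by (simp add: OP_def msa_def)

lemma OP_size_unique: "\<lbrakk>p \<in> OP V m; p \<in> OP V n\<rbrakk> \<Longrightarrow> m = n"
  using OP_carrier by (metis carrier_matD(1))

lemma PIsom_carrier: "v \<in> PIsom V m n \<Longrightarrow> v \<in> carrier_mat m n"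
  by (simp add: PIsom_def)

lemma OP_infI: "\<lbrakk>0 < n; p \<in> OP V n\<rbrakk> \<Longrightarrow> p \<in> OP_inf V"
  by (auto simp: OP_inf_def)

lemma proj_equivI:
  "\<lbrakk>0 < m; 0 < n; v \<in> PIsom V m n\<rbrakk> \<Longrightarrow> proj_equiv V (mabs V (mstar V v)) (mabs V v)"
  unfolding proj_equiv_def
  by (intro exI[of _ m] exI[of _ n] conjI bexI[of _ v]) (auto simp: PIsom_def)

lemma proj_leE:
  assumes "proj_le V p q"
  obtains m n v where "0 < m" "0 < n" "v \<in> PIsom V m n" "p = mabs V (mstar V v)"
    "p \<in> OP V m" "q \<in> OP V n" "mabs V v \<in> OP V n" "cone_le (cone V n) (mabs V v) q"
proof -
  obtain n r where n: "n \<ge> 1" "q \<in> OP V n" "r \<in> OP V n" "proj_equiv V p r"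
    and le: "cone_le (cone V n) r q"
    using assms by (auto simp: proj_le_def)
  obtain m n' v where v: "m \<ge> 1" "p \<in> OP V m" "r \<in> OP V n'" "v \<in> PIsom V m n'"
    "p = mabs V (mstar V v)" "r = mabs V v"
    using n(4) by (auto simp: proj_equiv_def)
  have "n' = n" using OP_size_unique[OF v(3) n(3)] .
  then show thesis using that[of m n v] n v le by simp
qed

lemma proj_leI:
  assumes "0 < m" "0 < n" "v \<in> PIsom V m n" "q \<in> OP V n" "cone_le (cone V n) (mabs V v) q"
  shows "proj_le V (mabs V (mstar V v)) q"
proof -
  have "mabs V (mstar V v) \<in> OP V m" "mabs V v \<in> OP V n"
    using assms(3) by (auto simp: PIsom_def)
  then show ?thesis
    unfolding proj_le_def
    by (intro conjI exI[of _ n] bexI[of _ "mabs V v"])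
      (use assms(1,2) in \<open>simp_all add: OP_infI[of m] assms(4,5) proj_equivI[OF assms(1-3)]\<close>)
qed

context absolute_matrix_order_unit_space
begin

text \<open>Order projections are positive since \<open>2p = |2p - e| + (2p - e)\<close>.\<close>

lemma OP_cone:
  assumes "0 < n" and p: "p \<in> OP V n"
  shows "p \<in> cone V n"
proof -
  interpret absolutely_ordered_space "msa V n" "0\<^sub>m n n" "rscale V" "cone V n" "mabs V"
    using assms(1) by (rule abs_ordered)
  let ?e = "unit_mat V n"
  have abs: "mabs V (rscale V 2 p - ?e) = ?e" and sa: "p \<in> msa V n"
    using p by (auto simp: OP_def)
  have "?e \<in> cone V n"
    using mabs_closed[OF assms(1,1), of "rscale V 2 p - ?e"] abs minus_carrier_mat[of ?e n n]
    by simp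
  then have "rscale V 2 p - ?e \<in> msa V n"
    by (intro diff_closed scale_closed sa cone_in)
  then have "?e + (rscale V 2 p - ?e) \<in> cone V n"
    using ab_plus[of "rscale V 2 p - ?e"] abs by simp
  moreover have "?e + (rscale V 2 p - ?e) = rscale V 2 p"
    using OP_carrier[OF p] by (auto intro!: eq_matI simp: unit_mat_def rscale_def)
  ultimately have "rscale V (1/2) (rscale V 2 p) \<in> cone V n"
    using cone_scale[of "rscale V 2 p" "1/2"] by simp
  then show ?thesis
    using sa scale_scale[of p "1/2" 2] scale_one[of p] by simp
qed

lemma dsum_OP:
  assumes "0 < m" "0 < n" "p \<in> OP V m" "q \<in> OP V n"
  shows "dsum p q \<in> OP V (m + n)"
proof -
  have c: "p \<in> carrier_mat m m" "q \<in> carrier_mat n n"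
    using OP_carrier[OF assms(3)] OP_carrier[OF assms(4)] .
  have "rscale V 2 (dsum p q) - unit_mat V (m + n)
      = dsum (rscale V 2 p - unit_mat V m) (rscale V 2 q - unit_mat V n)"
    by (simp only: rscale_dsum dsum_unit_mat[symmetric] dsum_minus[OF
          rscale_carrier[OF c(1)] rscale_carrier[OF c(2)] unit_mat_carrier unit_mat_carrier])
  also have "mabs V \<dots> = dsum (mabs V (rscale V 2 p - unit_mat V m))
      (mabs V (rscale V 2 q - unit_mat V n))"
    by (intro mabs_dsum[of m m n n] assms(1,2) minus_carrier_mat unit_mat_carrier)
  also have "\<dots> = unit_mat V (m + n)"
    using assms(3,4) by (simp add: OP_def dsum_unit_mat)
  finally show ?thesis
    using assms(3,4) by (simp add: OP_def dsum_msa)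
qed

lemma proj_le_refl:
  assumes "0 < n" "p \<in> OP V n"
  shows "proj_le V p p"
proof -
  have p: "mabs V p = p" "mstar V p = p"
    using assms(2) mabs_cone[OF assms(1) OP_cone[OF assms]] by (auto simp: OP_def msa_def)
  then have "p \<in> PIsom V n n"
    using assms OP_carrier by (simp add: PIsom_def)
  then show ?thesis
    using proj_leI[OF assms(1,1) _ assms(2), of p] p cone_le_refl[OF assms(1) OP_cone[OF assms]]
    by simp
qed

lemma mabs_mstar_dsum:
  assumes "0 < m" "0 < n" "0 < m'" "0 < n'" "v \<in> carrier_mat m n" "w \<in> carrier_mat m' n'"
  shows "mabs V (mstar V (dsum v w)) = dsum (mabs V (mstar V v)) (mabs V (mstar V w))"
  unfolding mstar_dsum using assms by (intro mabs_dsum[of n m n' m'] mstar_carrier)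

lemma dsum_PIsom:
  assumes "0 < m" "0 < n" "0 < m'" "0 < n'" "v \<in> PIsom V m n" "w \<in> PIsom V m' n'"
  shows "dsum v w \<in> PIsom V (m + m') (n + n')"
proof -
  note c = PIsom_carrier[OF assms(5)] PIsom_carrier[OF assms(6)]
  show ?thesis
    using assms(5,6) unfolding PIsom_def mem_Collect_eq mabs_mstar_dsum[OF assms(1-4) c]
      mabs_dsum[OF assms(1-4) c]
    by (intro conjI dsum_carrier dsum_OP assms(1-4)) blast+
qed

lemma proj_le_dsum:
  assumes "proj_le V p r" "proj_le V q s"
  shows "proj_le V (dsum p q) (dsum r s)"
proof -
  obtain m n v where v: "0 < m" "0 < n" "v \<in> PIsom V m n" "p = mabs V (mstar V v)"
    "p \<in> OP V m" "r \<in> OP V n" "mabs V v \<in> OP V n" "cone_le (cone V n) (mabs V v) r"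
    by (rule proj_leE[OF assms(1)])
  obtain m' n' w where w: "0 < m'" "0 < n'" "w \<in> PIsom V m' n'" "q = mabs V (mstar V w)"
    "q \<in> OP V m'" "s \<in> OP V n'" "mabs V w \<in> OP V n'" "cone_le (cone V n') (mabs V w) s"
    by (rule proj_leE[OF assms(2)])
  note c = PIsom_carrier[OF v(3)] PIsom_carrier[OF w(3)]
  have "cone_le (cone V (n + n')) (mabs V (dsum v w)) (dsum r s)"
    unfolding mabs_dsum[OF v(1,2) w(1,2) c]
    by (intro cone_le_dsum OP_carrier[of _ V] v w)
  then have "proj_le V (mabs V (mstar V (dsum v w))) (dsum r s)"
    using v(1,2) by (intro proj_leI[of "m + m'" "n + n'"] dsum_PIsom dsum_OP v w) simp_all
  then show ?thesis
    unfolding v(4) w(4) mabs_mstar_dsum[OF v(1,2) w(1,2) c] .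
qed

lemma mstar_PIsom: "v \<in> PIsom V m n \<Longrightarrow> mstar V v \<in> PIsom V n m"
  by (auto simp: PIsom_def mstar_mstar)

text \<open>
  For \<open>p \<sim> |v| \<le> q\<close> and \<open>q \<sim> |u| \<le> t\<close> the partial isometry \<open>u\<^sup>*\<close> is cut down to \<open>u\<^sub>1\<close> with
  \<open>|u\<^sub>1| = |v|\<close>. Orthogonality of \<open>u\<^sub>1\<close> and \<open>u\<^sup>* - u\<^sub>1\<close> gives \<open>|u\<^sub>1\<^sup>*| \<le> |u|\<close>, and composing
  \<open>v\<close> with \<open>u\<^sub>1\<close> gives \<open>p \<sim> |u\<^sub>1\<^sup>*|\<close>.
\<close>

lemma proj_le_trans:
  assumes T: "\<And>l m n u v.
      \<lbrakk>1 \<le> l; 1 \<le> m; 1 \<le> n; u \<in> PIsom V m n; v \<in> PIsom V l n; mabs V u = mabs V v\<rbrakk>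
      \<Longrightarrow> \<exists>w\<in>PIsom V m l. mabs V (mstar V w) = mabs V (mstar V u) \<and> mabs V w = mabs V (mstar V v)"
    and H: "\<And>m n u p.
      \<lbrakk>1 \<le> m; 1 \<le> n; u \<in> PIsom V m n; p \<in> OP V n; cone_le (cone V n) p (mabs V u)\<rbrakk>
      \<Longrightarrow> \<exists>u1\<in>PIsom V m n. mperp V u1 (u - u1) \<and> p = mabs V u1"
    and pq: "proj_le V p q" and qt: "proj_le V q t"
  shows "proj_le V p t"
proof -
  obtain m n v where v: "0 < m" "0 < n" "v \<in> PIsom V m n" "p = mabs V (mstar V v)"
    "p \<in> OP V m" "q \<in> OP V n" "mabs V v \<in> OP V n" "cone_le (cone V n) (mabs V v) q"
    by (rule proj_leE[OF pq])
  obtain n' k u where u: "0 < n'" "0 < k" "u \<in> PIsom V n' k" "q = mabs V (mstar V u)"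
    "q \<in> OP V n'" "t \<in> OP V k" "mabs V u \<in> OP V k" "cone_le (cone V k) (mabs V u) t"
    by (rule proj_leE[OF qt])
  have "n' = n" using OP_size_unique[OF u(5) v(6)] .
  then have us: "mstar V u \<in> PIsom V k n" using mstar_PIsom[OF u(3)] by simp
  have "cone_le (cone V n) (mabs V v) (mabs V (mstar V u))"
    using v(8) u(4) by simp
  then obtain u1 where u1: "u1 \<in> PIsom V k n" "mperp V u1 (mstar V u - u1)"
      "mabs V v = mabs V u1"
    using H[OF _ _ us v(7)] u(2) v(2) by (auto simp: Suc_le_eq)
  have le: "cone_le (cone V k) (mabs V (mstar V u1)) (mabs V u)"
    using mabs_mstar_le_of_mperp[OF u(2) v(2) PIsom_carrier[OF us] PIsom_carrier[OF u1(1)] u1(2)]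
    by (simp only: mstar_mstar)
  obtain w where w: "w \<in> PIsom V m k" "mabs V (mstar V w) = p" "mabs V w = mabs V (mstar V u1)"
    using T[OF _ _ _ v(3) u1(1,3)] u(2) v(1,2,4) by (auto simp: Suc_le_eq)
  have "mabs V (mstar V u1) \<in> OP V k"
    using u1(1) by (simp add: PIsom_def)
  then have "cone_le (cone V k) (mabs V w) t"
    unfolding w(3) using u(6,7) by (intro cone_le_trans[OF u(2) _ _ _ le u(8)] OP_carrier)
  then show ?thesis
    using proj_leI[OF v(1) u(2) w(1) u(6)] w(2) by simp
qed

end

theorem proposition4p7:
  fixes V :: "('v::ab_group_add) amou_space"
  assumes V: "absolute_matrix_order_unit_space V"
    and T: "\<And>l m n u v.
      \<lbrakk>1 \<le> l; 1 \<le> m; 1 \<le> n; u \<in> PIsom V m n; v \<in> PIsom V l n; mabs V u = mabs V v\<rbrakk>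
      \<Longrightarrow> \<exists>w\<in>PIsom V m l. mabs V (mstar V w) = mabs V (mstar V u) \<and> mabs V w = mabs V (mstar V v)"
    and H: "\<And>m n u p.
      \<lbrakk>1 \<le> m; 1 \<le> n; u \<in> PIsom V m n; p \<in> OP V n; cone_le (cone V n) p (mabs V u)\<rbrakk>
      \<Longrightarrow> \<exists>u1\<in>PIsom V m n. mperp V u1 (u - u1) \<and> p = mabs V u1"
  shows "(reflp_on (OP_inf V) (proj_le V) \<and> transp_on (OP_inf V) (proj_le V)) \<and>
    (\<forall>p\<in>OP_inf V. \<forall>q\<in>OP_inf V. \<forall>r\<in>OP_inf V. \<forall>s\<in>OP_inf V.
       proj_le V p r \<longrightarrow> proj_le V q s \<longrightarrow> proj_le V (dsum p q) (dsum r s))"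
proof -
  interpret absolute_matrix_order_unit_space V by (rule V)
  show ?thesis
  proof (intro conjI ballI impI)
    show "reflp_on (OP_inf V) (proj_le V)"
      by (intro reflp_onI) (auto simp: OP_inf_def Suc_le_eq intro: proj_le_refl)
    show "transp_on (OP_inf V) (proj_le V)"
      by (rule transp_onI) (rule proj_le_trans[OF T H])
    show "proj_le V (dsum p q) (dsum r s)" if "proj_le V p r" "proj_le V q s" for p q r s
      using that by (rule proj_le_dsum)
  qed
qed

end
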